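(* The ERI space $(X_0,\tau_{\mathrm{ERI}})$ is not a KC-space; that is, it has a compact subset that is not closed.
   Context: Let $\overline{\mathbb{R}}=[-\infty,+\infty]$ be the extended real line with its order topology. Let $\sim$ be the equivalence relation on $\overline{\mathbb{R}}$ whose only non-singleton class is $\{-\infty,0,+\infty\}$, let $X_0=\overline{\mathbb{R}}/{\sim}$ be the quotient set, $q\colon\overline{\mathbb{R}}\to X_0$ the projection, and $\ast=q(-\infty)=q(0)=q(+\infty)$. The ERI topology $\tau_{\mathrm{ERI}}$ on $X_0$ consists of all $U\subseteq X_0$ such that (a) $q^{-1}(U)$ is open in $\overline{\mathbb{R}}$, and (b) if $\ast\in U$ then $q^{-1}(U)$ is dense in $\overline{\mathbb{R}}$. (This is a topology.) The ERI space is $X=(X_0,\tau_{\mathrm{ERI}})$. A space is KC if every compact subset is closed. *)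

theory Defs
  imports "HOL-Analysis.Analysis"
begin

definition eri_rel :: "(ereal \<times> ereal) set" where
  "eri_rel = {(x, y). x = y \<or> x \<in> {-\<infinity>, 0, \<infinity>} \<and> y \<in> {-\<infinity>, 0, \<infinity>}}"

definition eri_carrier :: "ereal set set" where
  "eri_carrier = UNIV // eri_rel"

definition eri_proj :: "ereal \<Rightarrow> ereal set" where
  "eri_proj x = eri_rel `` {x}"

definition eri_star :: "ereal set" where
  "eri_star = eri_proj 0"

definition eri_open :: "ereal set set \<Rightarrow> bool" where
  "eri_open U \<longleftrightarrow>
     U \<subseteq> eri_carrier \<and> open (eri_proj -` U) \<and>
     (eri_star \<in> U \<longrightarrow> closure (eri_proj -` U) = UNIV)"

definition ERI :: "ereal set topology" where
  "ERI = topology eri_open"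

lemma equiv_eri_rel: "equiv UNIV eri_rel"
  by (auto simp: eri_rel_def intro!: equivI refl_onI symI transI)

lemma eri_proj_eq_iff:
  "eri_proj x = eri_proj y \<longleftrightarrow> x = y \<or> x \<in> {-\<infinity>, 0, \<infinity>} \<and> y \<in> {-\<infinity>, 0, \<infinity>}"
  using eq_equiv_class_iff[OF equiv_eri_rel, of x y] by (simp add: eri_proj_def eri_rel_def)

lemma eri_proj_surj: "eri_proj ` UNIV = eri_carrier"
  by (auto simp: eri_proj_def eri_carrier_def quotient_def)

lemma eri_star_eq: "eri_proj (-\<infinity>) = eri_star" "eri_proj \<infinity> = eri_star"
  by (simp_all only: eri_star_def eri_proj_eq_iff) simp_all

lemma istopology_eri_open: "istopology eri_open"
  unfolding istopology_def
proof (intro conjI allI impI)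
  fix S T assume S: "eri_open S" and T: "eri_open T"
  show "eri_open (S \<inter> T)"
    unfolding eri_open_def
  proof (intro conjI impI)
    show "S \<inter> T \<subseteq> eri_carrier" "open (eri_proj -` (S \<inter> T))"
      using S T by (auto simp: eri_open_def)
    assume "eri_star \<in> S \<inter> T"
    then have o: "open (eri_proj -` S)" and c: "closure (eri_proj -` S) = UNIV"
        "closure (eri_proj -` T) = UNIV"
      using S T by (auto simp: eri_open_def)
    have "eri_proj -` S \<subseteq> closure (eri_proj -` S \<inter> eri_proj -` T)"
      using open_Int_closure_subset[OF o, of "eri_proj -` T"] c by simp
    then have "closure (eri_proj -` S) \<subseteq> closure (eri_proj -` S \<inter> eri_proj -` T)"
      by (simp add: closure_minimal)
    then show "closure (eri_proj -` (S \<inter> T)) = UNIV"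
      using c by auto
  qed
next
  fix \<K> assume K: "\<forall>K\<in>\<K>. eri_open K"
  show "eri_open (\<Union>\<K>)"
    unfolding eri_open_def
  proof (intro conjI impI)
    show "\<Union>\<K> \<subseteq> eri_carrier" "open (eri_proj -` (\<Union>\<K>))"
      using K by (auto simp: eri_open_def vimage_Union)
    assume "eri_star \<in> \<Union>\<K>"
    then obtain U where U: "U \<in> \<K>" "eri_star \<in> U" by blast
    then have "closure (eri_proj -` U) \<subseteq> closure (eri_proj -` (\<Union>\<K>))"
      by (intro closure_mono) auto
    then show "closure (eri_proj -` (\<Union>\<K>)) = UNIV"
      using K U by (auto simp: eri_open_def)
  qed
qed

lemma openin_ERI: "openin ERI = eri_open"
  by (simp add: ERI_def istopology_eri_open topology_inverse')

lemma topspace_ERI: "topspace ERI = eri_carrier"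
proof -
  have "eri_proj -` eri_carrier = UNIV"
    using eri_proj_surj by blast
  then have "openin ERI eri_carrier"
    by (simp add: openin_ERI eri_open_def)
  moreover have "topspace ERI \<subseteq> eri_carrier"
    using openin_topspace[of ERI] unfolding openin_ERI eri_open_def by blast
  ultimately show ?thesis
    by (simp add: openin_subset subset_antisym)
qed

end

theory Submission
  imports Defs
begin

text \<open>The image of \<open>[1, 2]\<close> is compact because the projection is continuous. It avoids the
  point \<open>*\<close>, so if it were closed then the complement of \<open>[1, 2]\<close> would be dense.\<close>

lemma continuous_map_eri_proj: "continuous_map euclidean ERI eri_proj"
proof -
  have "eri_proj \<in> UNIV \<rightarrow> eri_carrier"
    using eri_proj_surj by blast
  then show ?thesis
    by (auto simp: continuous_map_def topspace_ERI openin_ERI eri_open_def vimage_def)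
qed

lemma compactin_eri_proj_image:
  assumes "compact A"
  shows "compactin ERI (eri_proj ` A)"
  using image_compactin[OF _ continuous_map_eri_proj, of A] assms by simp

text \<open>Openness at \<open>eri_star\<close> forces a dense preimage, whereas the complement of a
  set with an interior point is never dense.\<close>

lemma not_closedin_eri_proj_image:
  assumes "A \<inter> {-\<infinity>, 0, \<infinity>} = {}" and "interior A \<noteq> {}"
  shows "\<not> closedin ERI (eri_proj ` A)"
proof
  assume "closedin ERI (eri_proj ` A)"
  then have op: "eri_open (eri_carrier - eri_proj ` A)"
    by (simp add: closedin_def topspace_ERI openin_ERI)
  \<comment> \<open>The only fibre of \<open>eri_proj\<close> with more than one point is
    \<open>{-\<infinity>, 0, \<infinity>}\<close>, so \<open>A\<close>, which avoids it, is
    saturated.\<close>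
  have inv: "eri_proj -` (eri_carrier - eri_proj ` A) = - A"
    using assms(1) by (auto simp: eri_proj_eq_iff simp flip: eri_proj_surj intro: rangeI)
  have "0 \<in> eri_proj -` (eri_carrier - eri_proj ` A)"
    unfolding inv using assms(1) by auto
  then have "eri_star \<in> eri_carrier - eri_proj ` A"
    by (simp add: eri_star_def)
  then have "closure (- A) = UNIV"
    using op unfolding eri_open_def inv by blast
  \<comment> \<open>The closure of \<open>- A\<close> is \<open>- interior A\<close>, so density
    would leave \<open>A\<close> without interior.\<close>
  then show False
    using assms(2) by (auto simp: closure_complement)
qed

theorem theorem3p19:
  shows "\<not> kc_space ERI \<and> (\<exists>K. compactin ERI K \<and> \<not> closedin ERI K)"
proof -
  have "{1<..<2::ereal} \<subseteq> interior {1..2}"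
    by (rule interior_maximal) auto
  moreover have "{1<..<2::ereal} \<noteq> {}"
    by simp
  ultimately have "interior {1..2::ereal} \<noteq> {}"
    by blast
  moreover have "{1..2::ereal} \<inter> {-\<infinity>, 0, \<infinity>} = {}"
    by auto
  ultimately have "\<not> closedin ERI (eri_proj ` {1..2})"
    by (intro not_closedin_eri_proj_image)
  \<comment> \<open>As \<open>ereal\<close> is compact Hausdorff, compactness of the interval
    reduces to its closedness.\<close>
  moreover have "compactin ERI (eri_proj ` {1..2})"
    by (simp add: compactin_eri_proj_image compact_eq_closed)
  ultimately show ?thesis
    unfolding kc_space_def by blast
qed

end
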